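(* Let $P_1$ and $P_2$ be Markov kernels on finite state spaces $S_1,S_2$ (each with at least two elements) with stationary distributions $\pi_1,\pi_2$ of full support, respectively. Consider the product chain $P=P_1\otimes P_2$ on $S_1\times S_2$ with $\pi=\pi_1\otimes\pi_2$. Then for each $(x_1,x_2)\in S_1\times S_2$, $$r_P(x_1,x_2)=\frac{\log(1/\pi_1(x_1))\,r_1(x_1)+\log(1/\pi_2(x_2))\,r_2(x_2)}{\log(1/\pi_1(x_1))+\log(1/\pi_2(x_2))},$$ where $r_1,r_2,r_P$ are the retention profiles of $P_1,P_2,P$ respectively.
   Context: All logarithms are natural, with $0\log0=0$. $D_{\mathrm{KL}}(\mu\|\nu)=\sum_{x}\mu(x)\log\frac{\mu(x)}{\nu(x)}$. For a Markov kernel $Q$ on a finite set with full-support stationary distribution $\rho$, its retention profile (with respect to $\rho$) is $r(x):=D_{\mathrm{KL}}(Q(x,\cdot)\|\rho)/\log(1/\rho(x))$. The product kernel is $(P_1\otimes P_2)((x_1,x_2),(y_1,y_2))=P_1(x_1,y_1)P_2(x_2,y_2)$ and $(\pi_1\otimes\pi_2)(x_1,x_2)=\pi_1(x_1)\pi_2(x_2)$. *)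

theory Defs
  imports "HOL-Probability.Probability"
begin

text \<open>A Markov kernel on a finite state space is a map \<open>K :: 'a::finite \<Rightarrow> 'a pmf\<close>;
  the entry \<open>K(x, y)\<close> is \<open>pmf (K x) y\<close>.\<close>

type_synonym 'a kernel = "'a \<Rightarrow> 'a pmf"

definition stationary :: "'a kernel \<Rightarrow> 'a pmf \<Rightarrow> bool" where
  "stationary K \<rho> \<longleftrightarrow> bind_pmf \<rho> K = \<rho>"

definition full_support :: "'a pmf \<Rightarrow> bool" where
  "full_support \<rho> \<longleftrightarrow> set_pmf \<rho> = UNIV"

text \<open>The convention \<open>0 log 0 = 0\<close> holds because \<open>ln 0 = 0\<close>. The value is meaningful only if
  \<open>set_pmf \<mu> \<subseteq> set_pmf \<nu>\<close>, in particular if \<open>\<nu>\<close> has full support; \<open>KL_div_eq_KL_divergence\<close> below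
  is the comparison with the measure-theoretic notion (whose first measure argument is
  the reference measure).\<close>

definition KL_div :: "'a::finite pmf \<Rightarrow> 'a pmf \<Rightarrow> real" where
  "KL_div \<mu> \<nu> = (\<Sum>x\<in>UNIV. pmf \<mu> x * ln (pmf \<mu> x / pmf \<nu> x))"

definition retention :: "'a::finite kernel \<Rightarrow> 'a pmf \<Rightarrow> 'a \<Rightarrow> real" where
  "retention K \<rho> x = KL_div (K x) \<rho> / ln (1 / pmf \<rho> x)"

definition prod_kernel :: "'a kernel \<Rightarrow> 'b kernel \<Rightarrow> ('a \<times> 'b) kernel" where
  "prod_kernel P1 P2 = (\<lambda>(x1, x2). pair_pmf (P1 x1) (P2 x2))"

lemma stationary_iff_sum:
  fixes K :: "'a::finite kernel"
  shows "stationary K \<rho> \<longleftrightarrow> (\<forall>y. (\<Sum>x\<in>UNIV. pmf \<rho> x * pmf (K x) y) = pmf \<rho> y)"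
  unfolding stationary_def pmf_eq_iff
  by (simp add: pmf_bind integral_measure_pmf[of UNIV] mult.commute)

lemma pmf_prod_kernel:
  "pmf (prod_kernel P1 P2 (x1, x2)) (y1, y2) = pmf (P1 x1) y1 * pmf (P2 x2) y2"
  by (simp add: prod_kernel_def pmf_pair)

lemma stationary_prod_kernel:
  assumes "stationary P1 \<pi>1" and "stationary P2 \<pi>2"
  shows "stationary (prod_kernel P1 P2) (pair_pmf \<pi>1 \<pi>2)"
proof -
  have "bind_pmf (pair_pmf \<pi>1 \<pi>2) (prod_kernel P1 P2)
      = bind_pmf \<pi>1 (\<lambda>x1. bind_pmf \<pi>2 (\<lambda>x2. bind_pmf (P1 x1) (\<lambda>y1.
          bind_pmf (P2 x2) (\<lambda>y2. return_pmf (y1, y2)))))"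
    by (simp add: pair_pmf_def prod_kernel_def bind_assoc_pmf bind_return_pmf)
  also have "\<dots> = bind_pmf \<pi>1 (\<lambda>x1. bind_pmf (P1 x1) (\<lambda>y1. bind_pmf \<pi>2 (\<lambda>x2.
          bind_pmf (P2 x2) (\<lambda>y2. return_pmf (y1, y2)))))"
    by (subst bind_commute_pmf[of \<pi>2]) (rule refl)
  also have "\<dots> = pair_pmf (bind_pmf \<pi>1 P1) (bind_pmf \<pi>2 P2)"
    by (simp add: pair_pmf_def bind_assoc_pmf)
  finally show ?thesis
    using assms by (simp add: stationary_def)
qed

lemma full_support_pair_pmf:
  assumes "full_support \<pi>1" and "full_support \<pi>2"
  shows "full_support (pair_pmf \<pi>1 \<pi>2)"
  using assms by (simp add: full_support_def)

lemma KL_div_eq_KL_divergence: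
  fixes \<mu> \<nu> :: "'a::finite pmf"
  assumes "full_support \<nu>"
  shows "KL_div \<mu> \<nu> = KL_divergence (exp 1) (measure_pmf \<nu>) (measure_pmf \<mu>)"
proof -
  let ?U = "count_space (UNIV :: 'a set)"
  have pos: "pmf \<nu> x \<noteq> 0" for x
    using assms by (simp add: full_support_def set_pmf_iff[symmetric])
  interpret sigma_finite_measure ?U
    by (rule sigma_finite_measure_count_space_finite) simp
  have "KL_divergence (exp 1) (density ?U (\<lambda>x. ennreal (pmf \<nu> x))) (density ?U (\<lambda>x. ennreal (pmf \<mu> x)))
      = (\<integral>x. pmf \<mu> x * log (exp 1) (pmf \<mu> x / pmf \<nu> x) \<partial>?U)"
    by (rule KL_density_density) (auto simp: pos)
  then show ?thesis
    by (simp add: KL_div_def measure_pmf_eq_density[symmetric] lebesgue_integral_count_space_finite log_def)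
qed

end

theory Submission
  imports Defs
begin

text \<open>Both ingredients of the retention profile are additive over independent coordinates. The
  logarithm turns the product mass of \<open>(x1, x2)\<close> into a sum, which gives the
  denominator. Relative entropy between product measures is the sum of the marginal relative
  entropies (\<open>KL_div_pair_pmf\<close>), which gives the numerator. Each marginal divergence is
  then rewritten as log(1/\<pi>i(xi)) times the retention of that factor, where the logarithm is
  nonzero by \<open>full_support_ln_inverse_pos\<close>.\<close>

lemma KL_div_pair_pmf:
  fixes \<mu>1 \<nu>1 :: "'a::finite pmf" and \<mu>2 \<nu>2 :: "'b::finite pmf"
  assumes "set_pmf \<mu>1 \<subseteq> set_pmf \<nu>1" and "set_pmf \<mu>2 \<subseteq> set_pmf \<nu>2"
  shows "KL_div (pair_pmf \<mu>1 \<mu>2) (pair_pmf \<nu>1 \<nu>2) = KL_div \<mu>1 \<nu>1 + KL_div \<mu>2 \<nu>2"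
proof -
  have abs_cont: "pmf \<nu>1 a = 0 \<Longrightarrow> pmf \<mu>1 a = 0" "pmf \<nu>2 b = 0 \<Longrightarrow> pmf \<mu>2 b = 0" for a b
    using assms by (auto simp: set_pmf_iff)
  \<comment> \<open>This is the pointwise form of additivity. If \<open>m\<close> or
    \<open>n\<close> vanishes, both sides are 0 whatever the logarithms are; otherwise absolute
    continuity makes \<open>p\<close> and \<open>q\<close> positive, so the logarithm of the
    quotient splits.\<close>
  have split: "(m * n) * ln ((m * n) / (p * q)) = (m * ln (m / p)) * n + m * (n * ln (n / q))"
    if "0 \<le> m" "0 \<le> n" "0 \<le> p" "0 \<le> q" "p = 0 \<longrightarrow> m = 0" "q = 0 \<longrightarrow> n = 0" for m n p q :: real
  proof (cases "m = 0 \<or> n = 0")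
    case False
    then have "0 < m" "0 < n" "0 < p" "0 < q"
      using that by auto
    then show ?thesis
      by (simp add: ln_mult ln_div algebra_simps)
  qed auto
  have total: "(\<Sum>a\<in>UNIV. pmf \<mu>1 a) = 1" "(\<Sum>b\<in>UNIV. pmf \<mu>2 b) = 1"
    by (auto intro: sum_pmf_eq_1)
  have "KL_div (pair_pmf \<mu>1 \<mu>2) (pair_pmf \<nu>1 \<nu>2)
      = (\<Sum>a\<in>UNIV. \<Sum>b\<in>UNIV. (pmf \<mu>1 a * pmf \<mu>2 b) * ln ((pmf \<mu>1 a * pmf \<mu>2 b) / (pmf \<nu>1 a * pmf \<nu>2 b)))"
    unfolding KL_div_def by (auto simp: sum.cartesian_product pmf_pair intro!: sum.cong)
  also have "\<dots> = (\<Sum>a\<in>UNIV. \<Sum>b\<in>UNIV. (pmf \<mu>1 a * ln (pmf \<mu>1 a / pmf \<nu>1 a)) * pmf \<mu>2 b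
      + pmf \<mu>1 a * (pmf \<mu>2 b * ln (pmf \<mu>2 b / pmf \<nu>2 b)))"
    using abs_cont by (intro sum.cong refl split) auto
  \<comment> \<open>In each summand only one coordinate carries a logarithm, so the double sum
    factors and the other coordinate contributes just its total mass, which is 1.\<close>
  also have "\<dots> = KL_div \<mu>1 \<nu>1 * (\<Sum>b\<in>UNIV. pmf \<mu>2 b) + (\<Sum>a\<in>UNIV. pmf \<mu>1 a) * KL_div \<mu>2 \<nu>2"
    by (simp add: KL_div_def sum.distrib sum_product)
  finally show ?thesis
    by (simp add: total)
qed

text \<open>A second point exists and has positive mass, so no single point can carry mass 1. This
  keeps the denominators of the retention profiles away from zero.\<close>

lemma full_support_ln_inverse_pos:
  fixes \<rho> :: "'a::finite pmf"
  assumes "full_support \<rho>" and "CARD('a) \<ge> 2"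
  shows "ln (1 / pmf \<rho> x) > 0"
proof -
  have pos: "pmf \<rho> x > 0"
    using assms(1) by (simp add: full_support_def pmf_positive)
  have "{x} \<noteq> UNIV"
    using assms(2) by (auto dest!: arg_cong[of _ _ card])
  then obtain y where "y \<noteq> x"
    by auto
  then have "pmf \<rho> x + pmf \<rho> y = measure_pmf.prob \<rho> {x, y}"
    by (simp add: measure_measure_pmf_finite)
  also have "\<dots> \<le> 1"
    by simp
  finally have "pmf \<rho> x < 1"
    using assms(1) by (simp add: full_support_def pmf_positive less_le_trans[of _ "pmf \<rho> x + pmf \<rho> y"])
  with pos show ?thesis
    by simp
qed

theorem propositionE1:
  fixes P1 :: "'a::finite kernel" and P2 :: "'b::finite kernel"
    and \<pi>1 :: "'a pmf" and \<pi>2 :: "'b pmf"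
    and x1 :: 'a and x2 :: 'b
  assumes "CARD('a) \<ge> 2" and "CARD('b) \<ge> 2"
    and "stationary P1 \<pi>1" and "stationary P2 \<pi>2"
    and "full_support \<pi>1" and "full_support \<pi>2"
  shows "retention (prod_kernel P1 P2) (pair_pmf \<pi>1 \<pi>2) (x1, x2) =
    (ln (1 / pmf \<pi>1 x1) * retention P1 \<pi>1 x1 + ln (1 / pmf \<pi>2 x2) * retention P2 \<pi>2 x2) /
    (ln (1 / pmf \<pi>1 x1) + ln (1 / pmf \<pi>2 x2))"
proof -
  have lpos: "ln (1 / pmf \<pi>1 x1) > 0" "ln (1 / pmf \<pi>2 x2) > 0"
    using assms by (auto intro: full_support_ln_inverse_pos simp del: ln_gt_zero_iff)
  have ppos: "pmf \<pi>1 x1 > 0" "pmf \<pi>2 x2 > 0"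
    using assms by (simp_all add: full_support_def pmf_positive)
  have "KL_div (prod_kernel P1 P2 (x1, x2)) (pair_pmf \<pi>1 \<pi>2)
      = KL_div (P1 x1) \<pi>1 + KL_div (P2 x2) \<pi>2"
    using assms unfolding prod_kernel_def by (simp add: KL_div_pair_pmf full_support_def)
  moreover have "ln (1 / pmf (pair_pmf \<pi>1 \<pi>2) (x1, x2)) = ln (1 / pmf \<pi>1 x1) + ln (1 / pmf \<pi>2 x2)"
    using ppos by (simp add: pmf_pair ln_div ln_mult)
  \<comment> \<open>Positivity of the logarithms allows the denominator in \<open>retention\<close>
    to be cancelled, recovering the divergences.\<close>
  moreover have "ln (1 / pmf \<pi>1 x1) * retention P1 \<pi>1 x1 = KL_div (P1 x1) \<pi>1"
    "ln (1 / pmf \<pi>2 x2) * retention P2 \<pi>2 x2 = KL_div (P2 x2) \<pi>2"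
    using lpos unfolding retention_def by (metis less_irrefl nonzero_mult_div_cancel_left times_divide_eq_right)+
  ultimately show ?thesis
    by (simp only: retention_def)
qed

end
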